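(* Let the guest graph $G=(V,E)$ and the host graph $T$ be binary regular trees of heights $h_G$ and $h=h_G+1$, respectively. Then the value of the objective function of the DAPT corresponding to the arrangement $\phi_A$ obtained from Algorithm $\mathcal{A}$ (described in the context) is $$OV(G,2,\phi_A)=\begin{cases}0 & \text{for } h_G=0,\\[2pt] \frac{29}{3}\cdot 2^{h_G}-4h_G-9+\frac13(-1)^{h_G} & \text{for } h_G\ge 1.\end{cases}$$
   Context: Binary regular tree: a rooted tree in which all leaves are at the same distance $h$ (the height) from the root and every non-leaf vertex has exactly two children (a left one and a right one); height $0$ means a single vertex. The two basic subtrees of a binary regular tree of height at least $1$ are the subtrees rooted at the left and at the right child of the root. Problem $DAPT(G,2)$: $G=(V,E)$ is a binary regular tree of height $h_G$ (the guest graph) with $2^{h_G+1}-1$ vertices, and $T$ is the binary regular tree of height $h=h_G+1$ (the host graph), with $b=2^{h_G+1}$ leaves. An arrangement is an injective map $\phi$ from $V$ to the set of leaves of $T$. Its objective value is $OV(G,2,\phi)=\sum_{(u,v)\in E} d_T(\phi(u),\phi(v))$, where $d_T$ is the number of edges on the unique path in $T$. Orders: the vertices of $G$ are labelled $v_1,\dots,v_n$ in canonical order (level by level from the root, left to right; so $v_1$ is the root, $v_2,v_3$ its left and right child). The leaves of $T$ are labelled $b_1,\dots,b_b$ from left to right, so that the leaves of the left basic subtree of $T$ are $b_1,\dots,b_{b/2}$, and recursively so in every subtree. Algorithm $\mathcal{A}$ (recursive; input $G$ of height $h_G$, output $\phi_A$). Put $b=2^{h_G+1}$. If $h_G=0$,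 set $\phi_A(v_1)=b_1$. If $h_G>0$: (i) apply the algorithm to the left and right basic subtrees of $G$ (of height $h_G-1$), obtaining arrangements $\widehat{\phi}_A^{(1)}$ and $\widehat{\phi}_A^{(2)}$; (ii) arrange the vertices of the left basic subtree on $b_1,\dots,b_{b/2}$ according to $\widehat{\phi}_A^{(1)}$ and those of the right basic subtree on $b_{b/2+1},\dots,b_b$ according to $\widehat{\phi}_A^{(2)}$; (iii) set $\phi_A(v_1)=b_{b/2}$ (this leaf is always free at this point); (iv) if $h_G$ is odd and $h_G\ge 3$, exchange the vertices arranged at the leaves $b_{b/4-1}$ and $b_{b/2}$ (pair-exchange). Return $\phi_A$. *)

theory Defs
  imports Complex_Main "HOL-Library.Tree" "HOL-Combinatorics.Transposition"
begin

text \<open>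
  A rooted ordered binary tree is represented by a value of type \<open>'a tree\<close> whose \<open>Node\<close>s are the
  vertices; the constructor \<open>Leaf\<close> stands for an absent child.  Hence the height of the library
  exceeds the number of edges on a longest root-to-leaf path by one, and the graph-theoretic
  leaves are the nodes of the form \<open>Node Leaf v Leaf\<close>.
\<close>

definition binary_regular_tree :: "nat \<Rightarrow> 'a tree \<Rightarrow> bool" where
  "binary_regular_tree h t \<longleftrightarrow>
     Tree.complete t \<and> height t = Suc h \<and> distinct (preorder t)"

text \<open>Each edge occurs exactly once, as the pair of the parent and the child.\<close>

fun tree_edges :: "'a tree \<Rightarrow> ('a \<times> 'a) set" where
  "tree_edges Leaf = {}"
| "tree_edges (Node l v r) =
     (\<lambda>c. (v, value c)) ` ({l, r} - {Leaf}) \<union> tree_edges l \<union> tree_edges r"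

fun tree_leaves :: "'a tree \<Rightarrow> 'a list" where
  "tree_leaves Leaf = []"
| "tree_leaves (Node l v r) =
     (if l = Leaf \<and> r = Leaf then [v] else tree_leaves l @ tree_leaves r)"

definition tree_path :: "'a tree \<Rightarrow> 'a \<Rightarrow> 'a list \<Rightarrow> 'a \<Rightarrow> bool" where
  "tree_path t x p y \<longleftrightarrow>
     p \<noteq> [] \<and> hd p = x \<and> last p = y \<and> distinct p \<and> set p \<subseteq> set_tree t \<and>
     successively (\<lambda>u v. (u, v) \<in> tree_edges t \<or> (v, u) \<in> tree_edges t) p"

text \<open>The number of edges on the path, which is given by its list of vertices.\<close>

definition tree_dist :: "'a tree \<Rightarrow> 'a \<Rightarrow> 'a \<Rightarrow> nat" where
  "tree_dist t x y = length (THE p. tree_path t x p y) - 1"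

definition OV :: "'a tree \<Rightarrow> 'b tree \<Rightarrow> ('a \<Rightarrow> 'b) \<Rightarrow> nat" where
  "OV G T \<phi> = (\<Sum>(u, v)\<in>tree_edges G. tree_dist T (\<phi> u) (\<phi> v))"

text \<open>
  \<open>algA_index G u\<close> is the index \<open>i\<close>, counted from 1, of the leaf \<open>b\<^sub>i\<close> at which the algorithm
  arranges the vertex \<open>u\<close> of \<open>G\<close>.  Since the library height of the absent child is \<open>0\<close>, the number
  \<open>height l\<close> below is the height \<open>h\<^sub>G\<close> of the guest tree in edges.  Composing with the transposition
  exchanges the vertices arranged at the two leaves.
\<close>

fun algA_index :: "'a tree \<Rightarrow> 'a \<Rightarrow> nat" where
  "algA_index Leaf = (\<lambda>_. undefined)"
| "algA_index (Node l v r) =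
     (let hG = height l; b = 2 ^ (hG + 1) in
      if hG = 0 then (\<lambda>_. undefined)(v := 1)
      else
        let \<phi> = (\<lambda>u. if u \<in> set_tree l then algA_index l u
                      else b div 2 + algA_index r u)(v := b div 2)
        in if odd hG \<and> hG \<ge> 3 then transpose (b div 4 - 1) (b div 2) \<circ> \<phi> else \<phi>)"

definition algA :: "'a tree \<Rightarrow> 'b tree \<Rightarrow> 'a \<Rightarrow> 'b" where
  "algA G T u = tree_leaves T ! (algA_index G u - 1)"

end

theory Submission imports Defs begin

text \<open>
  Write \<open>c h\<close> for the objective value of the arrangement that the algorithm computes for a guest of
  height \<open>h\<close>.  The two basic subtrees of the guest are arranged on the two halves of the host, and
  distances inside a half are those of the smaller host, so they contribute \<open>2 * c (h - 1)\<close>.  The root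
  sits on the last leaf of the left half.  Its right child lies in the other half, at distance
  \<open>2 * (h + 1)\<close>; its left child lies in the first quarter, at distance \<open>2 * h\<close>, because the root of an
  arranged subtree always occupies the left half of its host.  Without the pair-exchange this gives
  \<open>c h = 2 * c (h - 1) + 4 * h + 2\<close>.

  The pair-exchange, for odd \<open>h \<ge> 3\<close>, saves exactly \<open>2\<close>.  The leaf \<open>b / 4 - 1\<close> is occupied by a leaf
  \<open>x\<close> of the guest, whose only neighbour \<open>p\<close> occupies the leaf \<open>b / 4 - 2\<close>.  As the left basic subtree
  has even height, its root occupies the leaf \<open>b / 4\<close>.  The root moves next to its left child, so
  that this distance drops from \<open>2 * h\<close> to \<open>2\<close> and the distance to the right child is unchanged; the
  edge between \<open>p\<close> and \<open>x\<close> grows from \<open>4\<close> to \<open>2 * h\<close>.  Solving the recurrence gives the formula.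

  The tree distance is defined through the unique simple path, and lemma \<open>tree_dist_leaves\<close> replaces
  it by an arithmetic function of the two leaf positions.  The positions near the right end are
  controlled by \<open>algA_index_last_edge\<close>, and the two halves of the recurrence are
  \<open>edge_sum_unexchanged\<close> and \<open>edge_sum_exchanged\<close>.
\<close>

section \<open>Simple paths in a tree\<close>

abbreviation tree_adj :: "'a tree \<Rightarrow> 'a \<Rightarrow> 'a \<Rightarrow> bool" where
  "tree_adj t u w \<equiv> (u, w) \<in> tree_edges t \<or> (w, u) \<in> tree_edges t"

lemma value_in_set_tree: "t \<noteq> Leaf \<Longrightarrow> value t \<in> set_tree t"
  by (cases t) auto

lemma tree_edges_vertices:
  "(u, w) \<in> tree_edges t \<Longrightarrow> u \<in> set_tree t \<and> w \<in> set_tree t"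
  by (induction t) (auto simp: value_in_set_tree)

lemma tree_adj_vertices: "tree_adj t u w \<Longrightarrow> u \<in> set_tree t \<and> w \<in> set_tree t"
  using tree_edges_vertices by metis

lemma tree_adj_from_child:
  assumes "distinct (preorder (Node l v r))" "c \<in> {l, r}" "u \<in> set_tree c"
    and "tree_adj (Node l v r) u w"
  shows "w = v \<and> u = value c \<or> tree_adj c u w"
  using assms value_in_set_tree[of l] value_in_set_tree[of r]
  by (auto dest!: tree_edges_vertices)

lemma tree_adj_from_root:
  assumes "distinct (preorder (Node l v r))" "tree_adj (Node l v r) v w"
  shows "\<exists>c\<in>{l, r}. c \<noteq> Leaf \<and> w = value c"
  using assms value_in_set_tree[of l] value_in_set_tree[of r]
  by (auto dest!: tree_edges_vertices)

lemma tree_adj_child: "c \<in> {l, r} \<Longrightarrow> tree_adj c u w \<Longrightarrow> tree_adj (Node l v r) u w"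
  by auto

lemma tree_adj_root_child:
  "c \<in> {l, r} \<Longrightarrow> c \<noteq> Leaf \<Longrightarrow> tree_adj (Node l v r) v (value c)"
  by auto

text \<open>
  The only edge that leaves a child tree ends in the root, so a path that starts in a child tree and
  avoids the root can never leave it.
\<close>

lemma path_avoiding_root_in_child:
  assumes "distinct (preorder (Node l v r))" "c \<in> {l, r}"
    and "successively (tree_adj (Node l v r)) p" "p \<noteq> []" "hd p \<in> set_tree c" "v \<notin> set p"
  shows "set p \<subseteq> set_tree c \<and> successively (tree_adj c) p"
  using assms(3-6)
proof (induction p)
  case (Cons x p)
  show ?case
  proof (cases "p = []")
    case False
    have a: "tree_adj (Node l v r) x (hd p)" "successively (tree_adj (Node l v r)) p"
      using Cons.prems(1) False by (simp_all only: successively_Cons, simp_all)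
    have "hd p \<noteq> v" using Cons.prems(4) False by (cases p) auto
    then have "tree_adj c x (hd p)"
      using tree_adj_from_child[OF assms(1,2) _ a(1)] Cons.prems(3) by auto
    then show ?thesis
      using Cons a(2) False tree_adj_vertices[of x "hd p" c] by (simp add: successively_Cons)
  qed (use Cons in auto)
qed simp

lemma tree_path_sym: "tree_path t x p y \<Longrightarrow> tree_path t y (rev p) x"
  unfolding tree_path_def by (auto simp: hd_rev last_rev successively_rev disj_commute)

lemma tree_path_ends: "tree_path t x p y \<Longrightarrow> x \<in> set_tree t \<and> y \<in> set_tree t"
  unfolding tree_path_def using hd_in_set last_in_set by blast

lemma tree_path_length: "tree_path t x p y \<Longrightarrow> 0 < length p"
  by (simp add: tree_path_def)

text \<open>
  Together with \<open>tree_path_child_cases\<close>, this describes a simple path recursively, which is what the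
  uniqueness proof needs.  Here the path starts in the root, which it cannot visit again, so after
  its first step it stays in one child tree.
\<close>

lemma tree_path_root_cases:
  assumes d: "distinct (preorder (Node l v r))" and p: "tree_path (Node l v r) v p y"
  obtains "y = v" "p = [v]"
  | c q where "c \<in> {l, r}" "p = v # q" "tree_path c (value c) q y"
proof -
  from p obtain q where q: "p = v # q" unfolding tree_path_def by (cases p) auto
  show ?thesis
  proof (cases "q = []")
    case True
    then show ?thesis using p q that(1) unfolding tree_path_def by auto
  next
    case False
    have s: "tree_adj (Node l v r) v (hd q)" "successively (tree_adj (Node l v r)) q"
      using p q False unfolding tree_path_def by (simp_all only: successively_Cons, simp_all)
    from tree_adj_from_root[OF d s(1)]
    obtain c where c: "c \<in> {l, r}" "c \<noteq> Leaf" "hd q = value c" by blast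
    have "v \<notin> set q" using p q unfolding tree_path_def by auto
    then have "set q \<subseteq> set_tree c \<and> successively (tree_adj c) q"
      using path_avoiding_root_in_child[OF d c(1) s(2) False] c value_in_set_tree[of c] by auto
    then have "tree_path c (value c) q y"
      using p q False c unfolding tree_path_def by auto
    then show ?thesis using that(2) c(1) q by blast
  qed
qed

lemma children_disjoint:
  "distinct (preorder (Node l v r)) \<Longrightarrow> c \<in> {l, r} \<Longrightarrow> c' \<in> {l, r} \<Longrightarrow>
    x \<in> set_tree c \<Longrightarrow> x \<in> set_tree c' \<Longrightarrow> c = c'"
  by auto

text \<open>
  A simple path that starts in a child tree either stays there or leaves it through the root.  In
  the second case it cannot return, since it would have to pass the root of the child tree twice.
\<close>

lemma tree_path_child_cases:
  assumes d: "distinct (preorder (Node l v r))" and c: "c \<in> {l, r}" and x: "x \<in> set_tree c"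
    and p: "tree_path (Node l v r) x p y"
  obtains "tree_path c x p y"
  | p1 p2 where "y \<notin> set_tree c" "p = p1 @ p2" "tree_path c x p1 (value c)"
      "tree_path (Node l v r) v p2 y"
proof (cases "v \<in> set p")
  case False
  then have "tree_path c x p y"
    using path_avoiding_root_in_child[OF d c, of p] p x unfolding tree_path_def by auto
  then show ?thesis by (rule that(1))
next
  case True
  have vc: "v \<notin> set_tree c" using d c by auto
  from True obtain p1 q where pq: "p = p1 @ v # q" by (meson split_list)
  have v1: "v \<notin> set p1" "v \<notin> set q" using p pq unfolding tree_path_def by auto
  have ne: "p1 \<noteq> []" using p pq x vc unfolding tree_path_def by auto
  have s: "successively (tree_adj (Node l v r)) p1" "tree_adj (Node l v r) (last p1) v"
    "successively (tree_adj (Node l v r)) (v # q)"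
    using p pq ne unfolding tree_path_def by (simp_all only: successively_append_iff, simp_all)
  have hd1: "hd p1 = x" using p pq ne unfolding tree_path_def by auto
  have s1: "set p1 \<subseteq> set_tree c \<and> successively (tree_adj c) p1"
    using path_avoiding_root_in_child[OF d c s(1) ne] hd1 x v1 by auto
  then have lc: "last p1 \<in> set_tree c" using ne by auto
  have "last p1 = value c"
    using tree_adj_from_child[OF d c lc s(2)] vc tree_adj_vertices[of "last p1" v c] by auto
  then have path1: "tree_path c x p1 (value c)"
    using s1 hd1 ne p pq unfolding tree_path_def by auto
  have path2: "tree_path (Node l v r) v (v # q) y"
    using s(3) p pq unfolding tree_path_def by auto
  have "y \<notin> set_tree c"
  proof
    assume y: "y \<in> set_tree c"
    show False
    proof (cases rule: tree_path_root_cases[OF d path2])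
      case 1
      then show False using y vc by simp
    next
      case (2 c' q')
      then have "c' = c"
        using children_disjoint[OF d c _ y] tree_path_ends by metis
      then have "hd q = last p1" "q \<noteq> []"
        using 2 \<open>last p1 = value c\<close> unfolding tree_path_def by auto
      then have "last p1 \<in> set p1 \<inter> set q" using ne by (metis IntI hd_in_set last_in_set)
      then show False using p pq unfolding tree_path_def by auto
    qed
  qed
  then show ?thesis using that(2) pq path1 path2 by blast
qed

lemma tree_path_unique:
  assumes "distinct (preorder t)" "tree_path t x p y" "tree_path t x q y"
  shows "p = q"
  using assms
proof (induction t arbitrary: x y p q)
  case Leaf
  then show ?case by (auto simp: tree_path_def)
next
  case (Node l v r)
  note d = Node.prems(1)
  have IH: "p = q" if "c \<in> {l, r}" "tree_path c x p y" "tree_path c x q y" for c x y p q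
    using that Node.IH d by auto
  have root: "p = q" if p: "tree_path (Node l v r) v p y" and q: "tree_path (Node l v r) v q y"
    for p q
  proof (cases rule: tree_path_root_cases[OF d p])
    case 1
    with q show ?thesis
      by (cases rule: tree_path_root_cases[OF d q]) (use d in \<open>auto dest: tree_path_ends\<close>)
  next
    case (2 c p')
    note p' = this
    show ?thesis
    proof (cases rule: tree_path_root_cases[OF d q])
      case 1
      with p' d show ?thesis by (auto dest: tree_path_ends)
    next
      case (2 c' q')
      then have "c' = c"
        using children_disjoint[OF d p'(1) 2(1), of y] p'(3) tree_path_ends by metis
      then show ?thesis using IH[OF p'(1,3)] 2 p'(2) by simp
    qed
  qed
  show ?case
  proof (cases "x = v")
    case True
    then show ?thesis using root Node.prems by blast
  next
    case False
    then have "\<exists>c\<in>{l, r}. x \<in> set_tree c"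
      using tree_path_ends[OF Node.prems(2)] by auto
    then obtain c where c: "c \<in> {l, r}" "x \<in> set_tree c" by blast
    show ?thesis
    proof (cases rule: tree_path_child_cases[OF d c Node.prems(2)])
      case 1
      then have "y \<in> set_tree c" by (auto dest: tree_path_ends)
      then show ?thesis
        using IH[OF c(1) 1] by (cases rule: tree_path_child_cases[OF d c Node.prems(3)]) auto
    next
      case (2 p1 p2)
      note p = this
      show ?thesis
      proof (cases rule: tree_path_child_cases[OF d c Node.prems(3)])
        case 1
        then show ?thesis using p by (auto dest: tree_path_ends)
      next
        case (2 q1 q2)
        then show ?thesis using p IH[OF c(1)] root by metis
      qed
    qed
  qed
qed

section \<open>Distances between vertices\<close>

lemma tree_dist_eqI:
  assumes "distinct (preorder t)" "tree_path t x p y"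
  shows "tree_dist t x y = length p - 1"
proof -
  have "(THE q. tree_path t x q y) = p"
    using assms(2) tree_path_unique[OF assms(1) _ assms(2)] by (rule the_equality)
  then show ?thesis by (simp add: tree_dist_def)
qed

text \<open>
  Conversely, the next three lemmas assemble a path of the whole tree from paths in the child
  trees, following the same case distinction.
\<close>

lemma tree_path_child:
  assumes "c \<in> {l, r}" "tree_path c x p y"
  shows "tree_path (Node l v r) x p y"
proof -
  have "successively (tree_adj (Node l v r)) p"
    using assms(2) tree_adj_child[OF assms(1)] unfolding tree_path_def
    by (elim conjE successively_mono) blast
  then show ?thesis using assms unfolding tree_path_def by auto
qed

lemma tree_path_root:
  assumes "distinct (preorder (Node l v r))" "c \<in> {l, r}" "tree_path c (value c) p y"
  shows "tree_path (Node l v r) v (v # p) y"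
proof -
  have "c \<noteq> Leaf" using assms(3) by (auto dest: tree_path_ends)
  then have "tree_adj (Node l v r) v (hd p)" "p \<noteq> []"
    using tree_adj_root_child[OF assms(2)] assms(3) unfolding tree_path_def by auto
  moreover have "v \<notin> set p" using assms unfolding tree_path_def by auto
  ultimately show ?thesis using tree_path_child[OF assms(2,3), of v]
    unfolding tree_path_def by (simp only: successively_Cons) auto
qed

lemma tree_path_across_root:
  assumes d: "distinct (preorder (Node l v r))" and c: "c \<in> {l, r}"
    and y: "y \<notin> set_tree c" and p: "tree_path c x p (value c)" and q: "tree_path (Node l v r) v q y"
  shows "tree_path (Node l v r) x (p @ q) y"
proof -
  have vc: "v \<notin> set_tree c" using d c by auto
  have "set q \<inter> set_tree c = {}"
  proof (cases rule: tree_path_root_cases[OF d q])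
    case 1
    then show ?thesis using vc by simp
  next
    case (2 c' q')
    then have "y \<in> set_tree c'" "set q' \<subseteq> set_tree c'"
      by (auto dest: tree_path_ends simp: tree_path_def)
    then show ?thesis using children_disjoint[OF d c 2(1)] y vc 2(2) by auto
  qed
  then have "set p \<inter> set q = {}" using p unfolding tree_path_def by auto
  moreover have "tree_adj (Node l v r) (last p) (hd q)"
  proof -
    have "c \<noteq> Leaf" using tree_path_ends[OF p] by auto
    moreover have "last p = value c" "hd q = v" using p q unfolding tree_path_def by auto
    ultimately show ?thesis using tree_adj_root_child[OF c, of v] by metis
  qed
  ultimately show ?thesis using tree_path_child[OF c p, of v] q
    unfolding tree_path_def by (simp only: successively_append_iff) auto
qed

lemma tree_path_exists:
  assumes "distinct (preorder t)" "x \<in> set_tree t" "y \<in> set_tree t"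
  shows "\<exists>p. tree_path t x p y"
  using assms
proof (induction t arbitrary: x y)
  case (Node l v r)
  note d = Node.prems(1)
  have IH: "\<exists>p. tree_path c x p y" if "c \<in> {l, r}" "x \<in> set_tree c" "y \<in> set_tree c" for c x y
    using that Node.IH d by auto
  have root: "\<exists>p. tree_path (Node l v r) v p y" if "y \<in> set_tree (Node l v r)" for y
  proof (cases "y = v")
    case True
    then have "tree_path (Node l v r) v [v] y" by (simp add: tree_path_def)
    then show ?thesis by blast
  next
    case False
    then have "\<exists>c\<in>{l, r}. y \<in> set_tree c" using that by auto
    then obtain c where c: "c \<in> {l, r}" "y \<in> set_tree c" by blast
    then have "value c \<in> set_tree c" by (cases c) auto
    then show ?thesis using IH[OF c(1)] c tree_path_root[OF d c(1)] by blast
  qed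
  show ?case
  proof (cases "x = v")
    case False
    then have "\<exists>c\<in>{l, r}. x \<in> set_tree c" using Node.prems by auto
    then obtain c where c: "c \<in> {l, r}" "x \<in> set_tree c" by blast
    then have vc: "value c \<in> set_tree c" by (cases c) auto
    show ?thesis
    proof (cases "y \<in> set_tree c")
      case True
      then show ?thesis using IH c tree_path_child[OF c(1)] by blast
    next
      case False
      then show ?thesis
        using IH[OF c(1,2) vc] root[OF Node.prems(3)] tree_path_across_root[OF d c(1)] by blast
    qed
  qed (use root Node.prems in blast)
qed simp

lemma tree_dist_commute:
  assumes "distinct (preorder t)" "x \<in> set_tree t" "y \<in> set_tree t"
  shows "tree_dist t x y = tree_dist t y x"
proof -
  obtain p where p: "tree_path t x p y" using tree_path_exists[OF assms] by blast
  show ?thesis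
    using tree_dist_eqI[OF assms(1) p] tree_dist_eqI[OF assms(1) tree_path_sym[OF p]] by simp
qed

lemma distinct_preorder_child:
  "distinct (preorder (Node l v r)) \<Longrightarrow> c \<in> {l, r} \<Longrightarrow> distinct (preorder c)"
  by auto

lemma tree_dist_refl: "distinct (preorder t) \<Longrightarrow> x \<in> set_tree t \<Longrightarrow> tree_dist t x x = 0"
  using tree_dist_eqI[of t x "[x]" x] by (simp add: tree_path_def)

lemma tree_dist_child:
  assumes "distinct (preorder (Node l v r))" "c \<in> {l, r}" "x \<in> set_tree c" "y \<in> set_tree c"
  shows "tree_dist (Node l v r) x y = tree_dist c x y"
proof -
  have d: "distinct (preorder c)" using distinct_preorder_child[OF assms(1,2)] .
  obtain p where p: "tree_path c x p y" using tree_path_exists[OF d assms(3,4)] by blast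
  show ?thesis
    using tree_dist_eqI[OF assms(1) tree_path_child[OF assms(2) p]] tree_dist_eqI[OF d p] by simp
qed

lemma tree_dist_root:
  assumes d: "distinct (preorder (Node l v r))" and c: "c \<in> {l, r}" and y: "y \<in> set_tree c"
  shows "tree_dist (Node l v r) v y = Suc (tree_dist c (value c) y)"
proof -
  have "value c \<in> set_tree c" using y by (cases c) auto
  then obtain p where p: "tree_path c (value c) p y"
    using tree_path_exists[OF distinct_preorder_child[OF d c] _ y] by blast
  then show ?thesis
    using tree_dist_eqI[OF d tree_path_root[OF d c p]]
      tree_dist_eqI[OF distinct_preorder_child[OF d c] p] tree_path_length[OF p] by simp
qed

lemma tree_dist_across_root:
  assumes d: "distinct (preorder (Node l v r))" and x: "x \<in> set_tree l" and y: "y \<in> set_tree r"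
  shows "tree_dist (Node l v r) x y = tree_dist l (value l) x + tree_dist r (value r) y + 2"
proof -
  have v: "value l \<in> set_tree l" using x by (cases l) auto
  have dl: "distinct (preorder l)" using d by auto
  obtain p where p: "tree_path l x p (value l)"
    using tree_path_exists[OF dl x v] by blast
  obtain q where q: "tree_path (Node l v r) v q y"
    using tree_path_exists[OF d] y by fastforce
  have "y \<notin> set_tree l" using d y by auto
  then have "tree_dist (Node l v r) x y = length p + length q - 1"
    using tree_dist_eqI[OF d tree_path_across_root[OF d _ _ p q]] by simp
  also have "\<dots> = tree_dist l x (value l) + tree_dist (Node l v r) v y + 1"
    using tree_dist_eqI[OF dl p] tree_dist_eqI[OF d q] tree_path_length[OF p] tree_path_length[OF q]
    by linarith
  finally show ?thesis using tree_dist_root[OF d _ y] tree_dist_commute[OF dl x v] by simp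
qed

section \<open>Distances between the leaves of a regular tree\<close>

lemma binary_regular_tree_0: "binary_regular_tree 0 t \<longleftrightarrow> (\<exists>v. t = Node Leaf v Leaf)"
  by (cases t) (auto simp: binary_regular_tree_def max_def split: if_splits)

lemma binary_regular_tree_Suc:
  "binary_regular_tree (Suc h) t \<longleftrightarrow>
    (\<exists>l v r. t = Node l v r \<and> binary_regular_tree h l \<and> binary_regular_tree h r \<and>
      distinct (preorder t))"
  by (cases t) (auto simp: binary_regular_tree_def max_def split: if_splits)

lemma binary_regular_tree_nonempty: "\<not> binary_regular_tree h Leaf"
  by (simp add: binary_regular_tree_def)

lemma set_tree_leaves: "set (tree_leaves t) \<subseteq> set_tree t"
  by (induction t) auto

lemma length_tree_leaves: "binary_regular_tree h t \<Longrightarrow> length (tree_leaves t) = 2 ^ h"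
proof (induction h arbitrary: t)
  case (Suc h)
  then show ?case by (auto simp: binary_regular_tree_Suc binary_regular_tree_nonempty)
qed (auto simp: binary_regular_tree_0)

text \<open>
  In a regular tree every leaf has the same depth; this makes the distance of two leaves in
  different halves independent of the leaves.
\<close>

lemma tree_dist_root_leaf:
  "binary_regular_tree h t \<Longrightarrow> x \<in> set (tree_leaves t) \<Longrightarrow> tree_dist t (value t) x = h"
proof (induction h arbitrary: t)
  case 0
  then show ?case by (auto simp: binary_regular_tree_0 tree_dist_refl)
next
  case (Suc h)
  from Suc.prems(1) obtain l v r where t: "t = Node l v r" "binary_regular_tree h l"
    "binary_regular_tree h r" "distinct (preorder (Node l v r))"
    by (auto simp: binary_regular_tree_Suc)
  then obtain c where c: "c \<in> {l, r}" "x \<in> set (tree_leaves c)" "binary_regular_tree h c"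
    using Suc.prems(2) binary_regular_tree_nonempty by (auto split: if_splits)
  then show ?case
    using tree_dist_root[OF t(4) c(1)] set_tree_leaves[of c] Suc.IH[OF c(3,2)] t(1) by auto
qed

text \<open>
  The distance of the \<open>i\<close>-th and the \<open>j\<close>-th leaf, counted from 1, of the regular tree of height
  \<open>h\<close>: twice the height of their lowest common ancestor.
\<close>

fun leaf_dist :: "nat \<Rightarrow> nat \<Rightarrow> nat \<Rightarrow> nat" where
  "leaf_dist 0 i j = 0"
| "leaf_dist (Suc h) i j =
    (if i \<le> 2 ^ h \<and> j \<le> 2 ^ h then leaf_dist h i j
     else if 2 ^ h < i \<and> 2 ^ h < j then leaf_dist h (i - 2 ^ h) (j - 2 ^ h)
     else 2 * Suc h)"

lemma tree_dist_leaves: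
  assumes "binary_regular_tree h t" "1 \<le> i" "i \<le> 2 ^ h" "1 \<le> j" "j \<le> 2 ^ h"
  shows "tree_dist t (tree_leaves t ! (i - 1)) (tree_leaves t ! (j - 1)) = leaf_dist h i j"
  using assms
proof (induction h arbitrary: t i j)
  case 0
  then show ?case by (auto simp: binary_regular_tree_0 tree_dist_refl)
next
  case (Suc h)
  from Suc.prems(1) obtain l v r where t: "t = Node l v r" "binary_regular_tree h l"
    "binary_regular_tree h r" "distinct (preorder (Node l v r))"
    by (auto simp: binary_regular_tree_Suc)
  have lv: "tree_leaves t = tree_leaves l @ tree_leaves r"
    using t by (auto simp: binary_regular_tree_nonempty)
  have len: "length (tree_leaves l) = 2 ^ h" "length (tree_leaves r) = 2 ^ h"
    using t length_tree_leaves by auto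
  have left: "tree_leaves t ! (i - 1) = tree_leaves l ! (i - 1)"
      "tree_leaves l ! (i - 1) \<in> set (tree_leaves l)" if "1 \<le> i" "i \<le> 2 ^ h" for i
    using that lv len by (auto simp: nth_append)
  have right: "tree_leaves t ! (i - 1) = tree_leaves r ! (i - 2 ^ h - 1)"
      "tree_leaves r ! (i - 2 ^ h - 1) \<in> set (tree_leaves r)" if "2 ^ h < i" "i \<le> 2 ^ Suc h" for i
    using that lv len by (auto simp: nth_append less_diff_conv2 not_less_eq_eq diff_commute
        intro!: nth_mem)
  note sub = set_tree_leaves[of l, THEN subsetD] set_tree_leaves[of r, THEN subsetD]
  have across: "tree_dist t x y = 2 * Suc h"
    if "x \<in> set (tree_leaves l)" "y \<in> set (tree_leaves r)" for x y
    using tree_dist_across_root[OF t(4) sub(1)[OF that(1)] sub(2)[OF that(2)]]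
      tree_dist_root_leaf[OF t(2) that(1)] tree_dist_root_leaf[OF t(3) that(2)] t(1) by simp
  consider "i \<le> 2 ^ h" "j \<le> 2 ^ h" | "2 ^ h < i" "2 ^ h < j"
    | "i \<le> 2 ^ h" "2 ^ h < j" | "2 ^ h < i" "j \<le> 2 ^ h" by linarith
  then show ?case
  proof cases
    case 1
    then show ?thesis using Suc.prems left Suc.IH[OF t(2), of i j]
        tree_dist_child[OF t(4), of l] sub t(1) by simp
  next
    case 2
    then show ?thesis using Suc.prems right[of i] right[of j] Suc.IH[OF t(3), of "i - 2 ^ h" "j - 2 ^ h"]
        tree_dist_child[OF t(4), of r] sub t(1) by simp
  next
    case 3
    then show ?thesis using Suc.prems left[of i] right[of j] across by simp
  next
    case 4
    have "tree_dist t (tree_leaves t ! (i - 1)) (tree_leaves t ! (j - 1)) =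
      tree_dist t (tree_leaves t ! (j - 1)) (tree_leaves t ! (i - 1))"
      using 4 Suc.prems left[of j] right[of i] sub t
      by (intro tree_dist_commute) (simp_all)
    then show ?thesis using 4 Suc.prems left[of j] right[of i] across by simp
  qed
qed

lemma leaf_dist_left: "i \<le> 2 ^ h \<Longrightarrow> j \<le> 2 ^ h \<Longrightarrow> leaf_dist (Suc h) i j = leaf_dist h i j"
  by simp

lemma leaf_dist_right:
  "1 \<le> i \<Longrightarrow> 1 \<le> j \<Longrightarrow> leaf_dist (Suc h) (2 ^ h + i) (2 ^ h + j) = leaf_dist h i j"
  by simp

lemma leaf_dist_across:
  "i \<le> 2 ^ h \<Longrightarrow> 2 ^ h < j \<Longrightarrow> leaf_dist (Suc h) i j = 2 * Suc h"
  "i \<le> 2 ^ h \<Longrightarrow> 2 ^ h < j \<Longrightarrow> leaf_dist (Suc h) j i = 2 * Suc h"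
  by simp_all

declare leaf_dist.simps [simp del]

lemma leaf_dist_last_two: "leaf_dist (Suc h) (2 ^ Suc h - 1) (2 ^ Suc h) = 2"
proof (induction h)
  case (Suc h)
  have "leaf_dist (Suc (Suc h)) (2 ^ Suc h + (2 ^ Suc h - 1)) (2 ^ Suc h + 2 ^ Suc h) =
    leaf_dist (Suc h) (2 ^ Suc h - 1) (2 ^ Suc h)"
    using one_le_power[of "2::nat" h] by (intro leaf_dist_right; unfold power_Suc) linarith+
  then show ?case using Suc by simp
qed (simp add: leaf_dist.simps)

text \<open>
  The last but one and the last but two leaf are not siblings: they belong to the two
  neighbouring pairs that form the last four leaves.
\<close>

lemma leaf_dist_before_last:
  "leaf_dist (Suc (Suc h)) (2 ^ Suc (Suc h) - 2) (2 ^ Suc (Suc h) - 1) = 4"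
proof (induction h)
  case 0
  show ?case by (simp add: leaf_dist.simps)
next
  case (Suc h)
  have 1: "(1::nat) \<le> 2 ^ h" by simp
  have "leaf_dist (Suc (Suc (Suc h)))
      (2 ^ Suc (Suc h) + (2 ^ Suc (Suc h) - 2)) (2 ^ Suc (Suc h) + (2 ^ Suc (Suc h) - 1)) =
    leaf_dist (Suc (Suc h)) (2 ^ Suc (Suc h) - 2) (2 ^ Suc (Suc h) - 1)"
    using 1 by (intro leaf_dist_right; unfold power_Suc) linarith+
  moreover have "2 ^ Suc (Suc h) + (2 ^ Suc (Suc h) - 2) = (2 ^ Suc (Suc (Suc h)) - 2 :: nat)"
    "2 ^ Suc (Suc h) + (2 ^ Suc (Suc h) - 1) = (2 ^ Suc (Suc (Suc h)) - 1 :: nat)"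
    using 1 by (unfold power_Suc) linarith+
  ultimately show ?case using Suc by simp
qed

section \<open>Edge sums and pendant edges\<close>

text \<open>
  The objective value with the host tree replaced by an arbitrary distance \<open>d\<close> on the
  positions; the recursion below compares hosts of different heights.
\<close>

definition edge_sum :: "('i \<Rightarrow> 'i \<Rightarrow> nat) \<Rightarrow> ('a \<Rightarrow> 'i) \<Rightarrow> 'a tree \<Rightarrow> nat" where
  "edge_sum d f t = (\<Sum>(u, w)\<in>tree_edges t. d (f u) (f w))"

lemma finite_tree_edges: "finite (tree_edges t)"
  by (induction t) auto

lemma edge_sum_cong:
  assumes "\<And>u w. u \<in> set_tree t \<Longrightarrow> w \<in> set_tree t \<Longrightarrow> d (f u) (f w) = d' (g u) (g w)"
  shows "edge_sum d f t = edge_sum d' g t"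
  unfolding edge_sum_def by (rule sum.cong) (auto dest: tree_edges_vertices intro: assms)

lemma edge_sum_Node:
  assumes d: "distinct (preorder (Node l v r))" and ne: "l \<noteq> Leaf" "r \<noteq> Leaf"
  shows "edge_sum d f (Node l v r) =
    d (f v) (f (value l)) + d (f v) (f (value r)) + edge_sum d f l + edge_sum d f r"
proof -
  have vals: "value l \<in> set_tree l" "value r \<in> set_tree r" using ne value_in_set_tree by auto
  have disj: "v \<notin> set_tree l" "v \<notin> set_tree r" "set_tree l \<inter> set_tree r = {}" using d by auto
  then have "value l \<noteq> value r" using vals by auto
  have E: "tree_edges (Node l v r) =
    {(v, value l), (v, value r)} \<union> (tree_edges l \<union> tree_edges r)"
    using ne by auto
  have "tree_edges l \<inter> tree_edges r = {}"
    "{(v, value l), (v, value r)} \<inter> (tree_edges l \<union> tree_edges r) = {}"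
    using disj by (auto dest!: tree_edges_vertices)
  then show ?thesis
    unfolding edge_sum_def E using \<open>value l \<noteq> value r\<close>
    by (simp add: sum.union_disjoint finite_tree_edges del: Un_insert_left)
qed

text \<open>
  The vertex \<open>x\<close> has the parent \<open>p\<close> and no other neighbour, so \<open>x\<close> is a leaf of the guest.
\<close>

definition pendant_edge :: "'a tree \<Rightarrow> 'a \<Rightarrow> 'a \<Rightarrow> bool" where
  "pendant_edge t p x \<longleftrightarrow>
    p \<noteq> x \<and> (p, x) \<in> tree_edges t \<and>
    (\<forall>u w. (u, w) \<in> tree_edges t \<longrightarrow> u = x \<or> w = x \<longrightarrow> u = p \<and> w = x)"

lemma pendant_edge_vertices:
  "pendant_edge t p x \<Longrightarrow> p \<in> set_tree t \<and> x \<in> set_tree t"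
  unfolding pendant_edge_def by (blast dest: tree_edges_vertices)

lemma root_not_child: "distinct (preorder t) \<Longrightarrow> (u, w) \<in> tree_edges t \<Longrightarrow> w \<noteq> value t"
  by (cases t) (use value_in_set_tree in \<open>auto dest!: tree_edges_vertices\<close>)

text \<open>
  A new edge would have to join \<open>x\<close> to the new root.  This cannot happen: the child \<open>x\<close> of \<open>p\<close> is
  not the root of its own tree, and the new root is adjacent only to the roots of the child trees.
\<close>

lemma pendant_edge_child:
  assumes "distinct (preorder (Node l v r))" "c \<in> {l, r}" "pendant_edge c p x"
  shows "pendant_edge (Node l v r) p x"
proof -
  have e: "(p, x) \<in> tree_edges c" using assms(3) unfolding pendant_edge_def by auto
  have x: "x \<in> set_tree c" "x \<noteq> value c" "x \<noteq> v"
    using root_not_child[OF distinct_preorder_child[OF assms(1,2)] e] e assms(1,2)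
    by (auto dest!: tree_edges_vertices)
  have "(u, w) \<in> tree_edges c" if "(u, w) \<in> tree_edges (Node l v r)" "u = x \<or> w = x" for u w
    using that x assms(1,2) value_in_set_tree[of l] value_in_set_tree[of r]
    by (auto dest!: tree_edges_vertices)
  moreover have "tree_edges c \<subseteq> tree_edges (Node l v r)" using assms(2) by auto
  ultimately show ?thesis using assms(3) unfolding pendant_edge_def by blast
qed

lemma edge_sum_move_pendant:
  assumes "pendant_edge t p x"
  shows "edge_sum d (f(x := a)) t + d (f p) (f x) = edge_sum d f t + d (f p) a"
proof -
  have px: "(p, x) \<in> tree_edges t" "p \<noteq> x" using assms unfolding pendant_edge_def by auto
  have rest: "u \<noteq> x \<and> w \<noteq> x" if "(u, w) \<in> tree_edges t - {(p, x)}" for u w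
    using that assms unfolding pendant_edge_def by auto
  have "edge_sum d g t = d (g p) (g x) + (\<Sum>(u, w)\<in>tree_edges t - {(p, x)}. d (g u) (g w))" for g
    unfolding edge_sum_def using px by (subst sum.remove[OF finite_tree_edges]) auto
  moreover have "(\<Sum>(u, w)\<in>tree_edges t - {(p, x)}. d ((f(x := a)) u) ((f(x := a)) w)) =
      (\<Sum>(u, w)\<in>tree_edges t - {(p, x)}. d (f u) (f w))"
  proof (rule sum.cong[OF refl])
    fix e assume "e \<in> tree_edges t - {(p, x)}"
    then show "(case e of (u, w) \<Rightarrow> d ((f(x := a)) u) ((f(x := a)) w)) =
        (case e of (u, w) \<Rightarrow> d (f u) (f w))"
      using rest[of "fst e" "snd e"] by (simp add: case_prod_beta)
  qed
  ultimately show ?thesis using px by simp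
qed

section \<open>Positions chosen by the algorithm\<close>

text \<open>
  The arrangement of the tree with root \<open>v\<close> and child trees \<open>l\<close> and \<open>r\<close> before the pair-exchange.
\<close>

definition algA_unexchanged :: "'a tree \<Rightarrow> 'a \<Rightarrow> 'a tree \<Rightarrow> 'a \<Rightarrow> nat" where
  "algA_unexchanged l v r u =
    (if u = v then 2 ^ height l
     else if u \<in> set_tree l then algA_index l u else 2 ^ height l + algA_index r u)"

lemma binary_regular_tree_height: "binary_regular_tree h t \<Longrightarrow> height t = Suc h"
  by (simp add: binary_regular_tree_def)

text \<open>
  The height of the tree is \<open>Suc h\<close>, so the pair-exchange takes place when \<open>h\<close> is even and
  positive, and it concerns the leaves \<open>b / 4 - 1 = 2 ^ h - 1\<close> and \<open>b / 2 = 2 ^ Suc h\<close>.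
\<close>

lemma algA_index_Node:
  assumes "height l = Suc h"
  shows "algA_index (Node l v r) =
    (if even h \<and> 2 \<le> h
     then transpose (2 ^ h - 1) (2 ^ Suc h) \<circ> algA_unexchanged l v r
     else algA_unexchanged l v r)"
proof -
  have "(\<lambda>u. if u \<in> set_tree l then algA_index l u
          else 2 ^ (height l + 1) div 2 + algA_index r u)(v := 2 ^ (height l + 1) div 2) =
      algA_unexchanged l v r"
    by (auto simp: algA_unexchanged_def fun_eq_iff)
  moreover have "2 ^ (height l + 1) div 4 = (2 ^ h :: nat)" "2 ^ (height l + 1) div 2 = (2 ^ Suc h :: nat)"
    using assms by simp_all
  ultimately show ?thesis
    using assms by (simp add: Let_def cong: if_cong)
qed

declare algA_index.simps [simp del]

lemma algA_index_single: "algA_index (Node Leaf v Leaf) v = 1"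
  by (simp add: algA_index.simps)

context
  fixes h :: nat and l r :: "'a tree" and v :: 'a
  assumes brt: "binary_regular_tree h l" "binary_regular_tree h r"
    and dist: "distinct (preorder (Node l v r))"
begin

lemma algA_unexchanged_root: "algA_unexchanged l v r v = 2 ^ Suc h"
  by (simp add: algA_unexchanged_def binary_regular_tree_height[OF brt(1)])

lemma algA_unexchanged_left: "u \<in> set_tree l \<Longrightarrow> algA_unexchanged l v r u = algA_index l u"
  using dist by (auto simp: algA_unexchanged_def)

lemma algA_unexchanged_right:
  "u \<in> set_tree r \<Longrightarrow> algA_unexchanged l v r u = 2 ^ Suc h + algA_index r u"
  using dist by (auto simp: algA_unexchanged_def binary_regular_tree_height[OF brt(1)])

lemmas algA_unexchanged_simps =
  algA_unexchanged_root algA_unexchanged_left algA_unexchanged_right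

end

text \<open>
  The interval is open on the right: the last leaf of the host stays free.  This is what makes room
  for the root at the middle leaf, strictly between the positions of the two child trees.
\<close>

lemma algA_unexchanged_inj_range:
  assumes brt: "binary_regular_tree h l" "binary_regular_tree h r"
    and dist: "distinct (preorder (Node l v r))"
    and l: "algA_index l ` set_tree l \<subseteq> {1..<2 ^ Suc h}" "inj_on (algA_index l) (set_tree l)"
    and r: "algA_index r ` set_tree r \<subseteq> {1..<2 ^ Suc h}" "inj_on (algA_index r) (set_tree r)"
  shows "algA_unexchanged l v r ` set_tree (Node l v r) \<subseteq> {1..<2 ^ Suc (Suc h)}"
    and "inj_on (algA_unexchanged l v r) (set_tree (Node l v r))"
proof -
  note simps = algA_unexchanged_simps[OF brt dist]
  have lu: "1 \<le> algA_index l u" "algA_index l u < 2 ^ Suc h" if "u \<in> set_tree l" for u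
    using l(1) that by (auto simp: image_subset_iff)
  have ru: "1 \<le> algA_index r u" "algA_index r u < 2 ^ Suc h" if "u \<in> set_tree r" for u
    using r(1) that by (auto simp: image_subset_iff)
  have "1 \<le> algA_unexchanged l v r u \<and> algA_unexchanged l v r u < 2 ^ Suc (Suc h)"
    if u: "u \<in> set_tree (Node l v r)" for u
  proof -
    consider "u = v" | "u \<in> set_tree l" | "u \<in> set_tree r" using u by auto
    then show ?thesis
    proof cases
      case 2
      then show ?thesis using lu[OF 2] simps(2) by simp
    next
      case 3
      then show ?thesis using ru[OF 3] simps(3) by simp
    qed (simp add: simps(1))
  qed
  then show "algA_unexchanged l v r ` set_tree (Node l v r) \<subseteq> {1..<2 ^ Suc (Suc h)}"
    unfolding image_subset_iff by simp
  have sep: "algA_unexchanged l v r u < 2 ^ Suc h" if "u \<in> set_tree l" for u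
    using lu[OF that] simps(2)[OF that] by simp
  have sep': "2 ^ Suc h < algA_unexchanged l v r u" if "u \<in> set_tree r" for u
    using ru[OF that] simps(3)[OF that] by simp
  have il: "inj_on (algA_unexchanged l v r) (set_tree l)"
    using l(2) simps(2) by (simp add: inj_on_def)
  have ir: "inj_on (algA_unexchanged l v r) (set_tree r)"
    using r(2) simps(3) by (simp add: inj_on_def)
  have "algA_unexchanged l v r u \<noteq> algA_unexchanged l v r w"
    if "u \<in> set_tree l" "w \<in> set_tree r" for u w
    using sep[OF that(1)] sep'[OF that(2)] by simp
  then have "algA_unexchanged l v r ` set_tree l \<inter> algA_unexchanged l v r ` set_tree r = {}"
    by blast
  then have "inj_on (algA_unexchanged l v r) (set_tree l \<union> set_tree r)"
    using il ir unfolding inj_on_Un by blast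
  moreover have "algA_unexchanged l v r v \<noteq> algA_unexchanged l v r u"
    if "u \<in> set_tree l \<union> set_tree r" for u
    using that sep[of u] sep'[of u] unfolding simps(1) by auto
  ultimately show "inj_on (algA_unexchanged l v r) (set_tree (Node l v r))"
    by (auto simp: inj_on_insert)
qed

text \<open>
  The exchanged positions both lie in the interval, so the transposition permutes it.
\<close>

lemma algA_index_range_inj:
  assumes "binary_regular_tree h t"
  shows "algA_index t ` set_tree t \<subseteq> {1..<2 ^ Suc h} \<and> inj_on (algA_index t) (set_tree t)"
  using assms
proof (induction h arbitrary: t)
  case 0
  then show ?case by (auto simp: binary_regular_tree_0 algA_index_single)
next
  case (Suc h)
  then obtain l v r where t: "t = Node l v r" "binary_regular_tree h l"
    "binary_regular_tree h r" "distinct (preorder (Node l v r))"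
    by (auto simp: binary_regular_tree_Suc)
  note un = algA_unexchanged_inj_range[OF t(2-4)
      Suc.IH[OF t(2), THEN conjunct1] Suc.IH[OF t(2), THEN conjunct2]
      Suc.IH[OF t(3), THEN conjunct1] Suc.IH[OF t(3), THEN conjunct2]]
  show ?case
  proof (cases "even h \<and> 2 \<le> h")
    case False
    then show ?thesis
      using un unfolding t(1) algA_index_Node[OF binary_regular_tree_height[OF t(2)]]
      by (simp only: if_False simp_thms)
  next
    case True
    then have idx: "algA_index t =
        transpose (2 ^ h - 1) (2 ^ Suc h) \<circ> algA_unexchanged l v r"
      using t(1) algA_index_Node[OF binary_regular_tree_height[OF t(2)]] by simp
    have "2 ^ 1 \<le> (2::nat) ^ h" using True by (intro power_increasing) auto
    then have "2 ^ h - 1 \<in> {1..<2 ^ Suc (Suc h) :: nat}" "2 ^ Suc h \<in> {1..<2 ^ Suc (Suc h) :: nat}"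
      by auto
    then have "transpose (2 ^ h - 1) (2 ^ Suc h) ` {1..<2 ^ Suc (Suc h)} = {1..<2 ^ Suc (Suc h) :: nat}"
      by (metis transpose_image_eq)
    then have "algA_index t ` set_tree t \<subseteq> {1..<2 ^ Suc (Suc h)}"
      using image_mono[OF un(1), of "transpose (2 ^ h - 1) (2 ^ Suc h)"]
      unfolding idx image_comp[symmetric] unfolding t(1) by (simp only:)
    moreover have "inj_on (algA_index t) (set_tree t)"
      unfolding idx unfolding t(1)
      by (rule comp_inj_on[OF un(2)]) (meson inj_on_subset inj_transpose subset_UNIV)
    ultimately show ?thesis by blast
  qed
qed

lemmas algA_index_range = algA_index_range_inj[THEN conjunct1, unfolded image_subset_iff]

text \<open>
  The root is placed at the last leaf of the left half, and the pair-exchange can only move it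
  further to the left.
\<close>

lemma algA_index_root:
  assumes "binary_regular_tree h t"
  shows "algA_index t (value t) \<le> 2 ^ h"
proof (cases h)
  case 0
  then show ?thesis using assms by (auto simp: binary_regular_tree_0 algA_index_single)
next
  case (Suc k)
  then obtain l v r where t: "t = Node l v r" "binary_regular_tree k l"
    "binary_regular_tree k r" "distinct (preorder (Node l v r))"
    using assms by (auto simp: binary_regular_tree_Suc)
  then show ?thesis
    using algA_index_Node[OF binary_regular_tree_height[OF t(2)], of v r] Suc
    by (simp add: algA_unexchanged_root[OF t(2-4)] le_diff_conv)
qed

text \<open>
  The last two occupied positions belong to a leaf of the guest and its parent.  For height 1 these
  are the right child and the root.  In the induction step the pair is inherited from the right child
  tree, because the pair-exchange affects only positions in the left half.
\<close>

lemma algA_index_last_edge: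
  assumes "binary_regular_tree (Suc h) t"
  shows "\<exists>p x. pendant_edge t p x \<and>
    algA_index t p = 2 ^ Suc (Suc h) - 2 \<and> algA_index t x = 2 ^ Suc (Suc h) - 1"
  using assms
proof (induction h arbitrary: t)
  case 0
  then obtain l v r a b where t: "t = Node l v r" "l = Node Leaf a Leaf" "r = Node Leaf b Leaf"
    "distinct (preorder t)"
    by (auto simp: binary_regular_tree_Suc binary_regular_tree_0)
  then have "pendant_edge t v b" unfolding pendant_edge_def by auto
  moreover have "algA_index t v = 2" "algA_index t b = 3" using t by (auto simp: algA_index.simps)
  ultimately show ?case by auto
next
  case (Suc h)
  then obtain l v r where t: "t = Node l v r" "binary_regular_tree (Suc h) l"
    "binary_regular_tree (Suc h) r" "distinct (preorder (Node l v r))"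
    by (subst (asm) (3) binary_regular_tree_Suc) auto
  obtain p x where px: "pendant_edge r p x" "algA_index r p = 2 ^ Suc (Suc h) - 2"
    "algA_index r x = 2 ^ Suc (Suc h) - 1"
    using Suc.IH[OF t(3)] by blast
  have one: "(1::nat) \<le> 2 ^ h" by simp
  then have pow: "(2::nat) ^ Suc (Suc (Suc h)) = 8 * 2 ^ h" "(2::nat) ^ Suc (Suc h) = 4 * 2 ^ h"
    "(2::nat) ^ Suc h = 2 * 2 ^ h"
    by simp_all
  have un: "algA_unexchanged l v r p = 2 ^ Suc (Suc (Suc h)) - 2"
    "algA_unexchanged l v r x = 2 ^ Suc (Suc (Suc h)) - 1"
    using pendant_edge_vertices[OF px(1)] px(2,3) algA_unexchanged_right[OF t(2-4)] one
    unfolding pow by simp_all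
  have "transpose (2 ^ Suc h - 1) (2 ^ Suc (Suc h)) i = i"
    if "2 ^ Suc (Suc h) < i" for i :: nat
    using that one unfolding pow by (intro transpose_apply_other) linarith+
  then have "algA_index t u = algA_unexchanged l v r u"
    if "2 ^ Suc (Suc h) < algA_unexchanged l v r u" for u
    unfolding t(1) algA_index_Node[OF binary_regular_tree_height[OF t(2)]] using that by simp
  moreover have "2 ^ Suc (Suc h) < algA_unexchanged l v r p"
    "2 ^ Suc (Suc h) < algA_unexchanged l v r x"
    unfolding un using one unfolding pow by linarith+
  ultimately have "algA_index t p = algA_unexchanged l v r p"
    "algA_index t x = algA_unexchanged l v r x"
    by simp_all
  then show ?case using pendant_edge_child[OF t(4) _ px(1)] t(1) un by auto
qed

section \<open>The recurrence for the objective value\<close>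

text \<open>
  The constant is the distance \<open>2 * Suc h\<close> from the root to its left child plus the distance
  \<open>2 * Suc (Suc h)\<close> to its right child.
\<close>

lemma edge_sum_unexchanged:
  assumes brt: "binary_regular_tree h l" "binary_regular_tree h r"
    and dist: "distinct (preorder (Node l v r))"
  shows "edge_sum (leaf_dist (Suc (Suc h))) (algA_unexchanged l v r) l =
      edge_sum (leaf_dist (Suc h)) (algA_index l) l"
    and "edge_sum (leaf_dist (Suc (Suc h))) (algA_unexchanged l v r) r =
      edge_sum (leaf_dist (Suc h)) (algA_index r) r"
    and "edge_sum (leaf_dist (Suc (Suc h))) (algA_unexchanged l v r) (Node l v r) =
      edge_sum (leaf_dist (Suc h)) (algA_index l) l +
      edge_sum (leaf_dist (Suc h)) (algA_index r) r + 4 * h + 6"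
proof -
  note simps = algA_unexchanged_simps[OF assms]
  note range = algA_index_range[OF brt(1)] algA_index_range[OF brt(2)]
  have ne: "l \<noteq> Leaf" "r \<noteq> Leaf" using brt binary_regular_tree_nonempty by auto
  note vals = ne[THEN value_in_set_tree]
  show L: "edge_sum (leaf_dist (Suc (Suc h))) (algA_unexchanged l v r) l =
      edge_sum (leaf_dist (Suc h)) (algA_index l) l"
    using range(1)
    by (intro edge_sum_cong) (simp only: simps(2), intro leaf_dist_left, auto intro: less_imp_le)
  show R: "edge_sum (leaf_dist (Suc (Suc h))) (algA_unexchanged l v r) r =
      edge_sum (leaf_dist (Suc h)) (algA_index r) r"
    using range(2) by (intro edge_sum_cong) (simp only: simps(3), intro leaf_dist_right, auto)
  have "leaf_dist (Suc (Suc h)) (2 ^ Suc h) (algA_index l (value l)) = 2 * Suc h"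
    using algA_index_root[OF brt(1)] leaf_dist_left[of "2 ^ Suc h" "Suc h"]
      leaf_dist_across(2)[of "algA_index l (value l)" h "2 ^ Suc h"] by simp
  moreover have "leaf_dist (Suc (Suc h)) (2 ^ Suc h) (2 ^ Suc h + algA_index r (value r)) =
      2 * Suc (Suc h)"
    using range(2) vals(2) by (intro leaf_dist_across) auto
  ultimately show "edge_sum (leaf_dist (Suc (Suc h))) (algA_unexchanged l v r) (Node l v r) =
      edge_sum (leaf_dist (Suc h)) (algA_index l) l +
      edge_sum (leaf_dist (Suc h)) (algA_index r) r + 4 * h + 6"
    by (simp only: edge_sum_Node[OF dist ne] L R simps vals) simp
qed

text \<open>
  The exchange brings the root next to its left child, which shortens this edge from \<open>2 * Suc h\<close> to
  \<open>2\<close>.  The vertex \<open>x\<close> that makes room for the root is pendant, hence only its edge to \<open>p\<close> changes,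
  and it grows from \<open>4\<close> to \<open>2 * Suc h\<close>.
\<close>

lemma edge_sum_exchanged:
  assumes brt: "binary_regular_tree h l" "binary_regular_tree h r"
    and dist: "distinct (preorder (Node l v r))" and h: "even h" "2 \<le> h"
  shows "edge_sum (leaf_dist (Suc (Suc h)))
      (transpose (2 ^ h - 1) (2 ^ Suc h) \<circ> algA_unexchanged l v r) (Node l v r) + 2 =
    edge_sum (leaf_dist (Suc (Suc h))) (algA_unexchanged l v r) (Node l v r)"
proof -
  let ?f = "algA_unexchanged l v r"
  let ?d = "leaf_dist (Suc (Suc h))"
  obtain m where m: "h = Suc (Suc m)" using h by (metis add_2_eq_Suc le_Suc_ex)
  obtain ll vl lr where l: "l = Node ll vl lr" "binary_regular_tree (Suc m) ll"
    "binary_regular_tree (Suc m) lr" "distinct (preorder (Node ll vl lr))"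
    using brt(1) unfolding m by (subst (asm) binary_regular_tree_Suc) auto
  \<comment> \<open>The height of \<open>l\<close> is even, so the recursive call for \<open>l\<close> ends without an exchange.\<close>
  have idx_l: "algA_index l = algA_unexchanged ll vl lr"
    using algA_index_Node[OF binary_regular_tree_height[OF l(2)]] h(1) l(1) m by simp
  obtain p x where px: "pendant_edge ll p x" "algA_index ll p = 2 ^ h - 2"
    "algA_index ll x = 2 ^ h - 1"
    using algA_index_last_edge[OF l(2)] unfolding m by blast
  have pl: "pendant_edge l p x" using pendant_edge_child[OF l(4) _ px(1)] l(1) by simp
  note in_ll = pendant_edge_vertices[OF px(1)]
  note in_l = pendant_edge_vertices[OF pl]
  note simps = algA_unexchanged_simps[OF brt dist]
  note lsimps = algA_unexchanged_simps[OF l(2-4)]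
  have fp: "?f p = 2 ^ h - 2" and fx: "?f x = 2 ^ h - 1"
    using simps(2) in_l lsimps(2) in_ll px(2,3) idx_l by auto
  have vl: "value l = vl" "vl \<in> set_tree l" using l(1) by auto
  have fvl: "?f vl = 2 ^ h" using simps(2)[OF vl(2)] idx_l lsimps(1) m by simp
  have ne: "l \<noteq> Leaf" "r \<noteq> Leaf" using brt binary_regular_tree_nonempty by auto
  have vr: "value r \<in> set_tree r" using ne value_in_set_tree by auto
  have fvr: "2 ^ Suc h < ?f (value r)"
    using simps(3)[OF vr] algA_index_range[OF brt(2)] vr by auto
  have four: "4 \<le> (2::nat) ^ h" unfolding m by simp
  have xv: "x \<noteq> v" "x \<notin> set_tree r" "v \<notin> set_tree l" "v \<notin> set_tree r"
    using dist in_l by auto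
  have xvl: "x \<noteq> vl" using fx fvl four by auto
  have inj: "inj_on ?f (set_tree (Node l v r))"
    using algA_unexchanged_inj_range(2)[OF brt dist] algA_index_range_inj[OF brt(1)]
      algA_index_range_inj[OF brt(2)] by blast
  \<comment> \<open>As the arrangement is injective, the transposition moves no vertex besides \<open>x\<close> and the root.\<close>
  define g where "g = (?f(x := 2 ^ Suc h))(v := 2 ^ h - 1)"
  have g: "(transpose (2 ^ h - 1) (2 ^ Suc h) \<circ> ?f) u = g u" if u: "u \<in> set_tree (Node l v r)" for u
  proof -
    have "?f u = 2 ^ h - 1 \<longleftrightarrow> u = x" "?f u = 2 ^ Suc h \<longleftrightarrow> u = v"
      using inj_on_eq_iff[OF inj u, of x] inj_on_eq_iff[OF inj u, of v] in_l fx simps(1) by auto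
    then show ?thesis using xv(1) by (auto simp: g_def transpose_def)
  qed
  have "edge_sum ?d (transpose (2 ^ h - 1) (2 ^ Suc h) \<circ> ?f) (Node l v r) =
      edge_sum ?d g (Node l v r)"
    by (rule edge_sum_cong) (simp only: g)
  also have "\<dots> = ?d (2 ^ h - 1) (2 ^ h) + ?d (2 ^ h - 1) (?f (value r)) +
      edge_sum ?d g l + edge_sum ?d g r"
  proof -
    have "g v = 2 ^ h - 1" "g (value l) = 2 ^ h" "g (value r) = ?f (value r)"
      using xv xvl vl vr fvl by (auto simp: g_def)
    then show ?thesis using edge_sum_Node[OF dist ne, of ?d g] by (simp only:)
  qed
  also have "edge_sum ?d g l = edge_sum ?d (?f(x := 2 ^ Suc h)) l"
    using xv by (intro edge_sum_cong) (auto simp: g_def)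
  also have "edge_sum ?d g r = edge_sum ?d ?f r"
    using xv by (intro edge_sum_cong) (auto simp: g_def)
  also have "?d (2 ^ h - 1) (2 ^ h) = 2"
    using leaf_dist_last_two[of "Suc m"] leaf_dist_left[of "2 ^ h - 1" h "2 ^ h"]
      leaf_dist_left[of "2 ^ h - 1" "Suc h" "2 ^ h"] unfolding m[symmetric]
    by simp
  also have "?d (2 ^ h - 1) (?f (value r)) = 2 * Suc (Suc h)"
    using fvr by (intro leaf_dist_across) auto
  finally have after: "edge_sum ?d (transpose (2 ^ h - 1) (2 ^ Suc h) \<circ> ?f) (Node l v r) =
      2 + 2 * Suc (Suc h) + edge_sum ?d (?f(x := 2 ^ Suc h)) l + edge_sum ?d ?f r" .
  have "?d (2 ^ h - 2) (2 ^ h - 1) = 4"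
    using leaf_dist_before_last[of m] leaf_dist_left[of "2 ^ h - 2" h "2 ^ h - 1"]
      leaf_dist_left[of "2 ^ h - 2" "Suc h" "2 ^ h - 1"] unfolding m[symmetric]
    by simp
  moreover have "?d (2 ^ h - 2) (2 ^ Suc h) = 2 * Suc h"
    using leaf_dist_left[of "2 ^ h - 2" "Suc h" "2 ^ Suc h"]
      leaf_dist_across(1)[of "2 ^ h - 2" h "2 ^ Suc h"] by simp
  ultimately have "edge_sum ?d (?f(x := 2 ^ Suc h)) l + 4 = edge_sum ?d ?f l + 2 * Suc h"
    using edge_sum_move_pendant[OF pl, of ?d ?f "2 ^ Suc h"] fp fx by simp
  then show ?thesis
    using after edge_sum_unexchanged[OF brt dist] by simp
qed

lemma edge_sum_algA:
  assumes "binary_regular_tree h t"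
  shows "real (edge_sum (leaf_dist (Suc h)) (algA_index t) t) =
    (if h = 0 then 0 else 29 / 3 * 2 ^ h - 4 * real h - 9 + 1 / 3 * (-1) ^ h)"
  using assms
proof (induction h arbitrary: t)
  case 0
  then show ?case by (auto simp: binary_regular_tree_0 edge_sum_def)
next
  case (Suc h)
  then obtain l v r where t: "t = Node l v r" "binary_regular_tree h l"
    "binary_regular_tree h r" "distinct (preorder (Node l v r))"
    by (auto simp: binary_regular_tree_Suc)
  let ?e = "\<lambda>t. real (edge_sum (leaf_dist (Suc h)) (algA_index t) t)"
  have "real (edge_sum (leaf_dist (Suc (Suc h))) (algA_index t) t) =
      ?e l + ?e r + 4 * real h + 6 - (if even h \<and> 2 \<le> h then 2 else 0)"
    using edge_sum_exchanged[OF t(2-4)] edge_sum_unexchanged(3)[OF t(2-4)]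
    unfolding t(1) algA_index_Node[OF binary_regular_tree_height[OF t(2)]]
    by simp
  \<comment> \<open>For \<open>h = 0\<close> the closed form does not give the induction hypothesis, which is then \<open>0\<close>.\<close>
  then show ?case
    unfolding Suc.IH[OF t(2)] Suc.IH[OF t(3)]
    by (cases "even h"; cases "h = 0") (auto elim: oddE)
qed

theorem lemma10:
  fixes G :: "'a tree" and T :: "'b tree" and hG :: nat
  assumes "binary_regular_tree hG G"
    and "binary_regular_tree (hG + 1) T"
  shows "real (OV G T (algA G T)) =
    (if hG = 0 then 0
     else 29 / 3 * 2 ^ hG - 4 * real hG - 9 + 1 / 3 * (-1) ^ hG)"
proof -
  have "OV G T (algA G T) = edge_sum (tree_dist T) (algA G T) G"
    by (simp add: OV_def edge_sum_def)
  also have "\<dots> = edge_sum (leaf_dist (Suc hG)) (algA_index G) G"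
    unfolding algA_def using algA_index_range[OF assms(1)]
    by (intro edge_sum_cong tree_dist_leaves) (use assms(2) in \<open>auto intro: less_imp_le\<close>)
  finally show ?thesis using edge_sum_algA[OF assms(1)] by simp
qed

end
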